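(* Let $k\ge 0$ and $l>0$ be integers. Let $\Gamma_k^l$ be the subgraph of the (right) Cayley graph of Thompson's group $F$ with respect to the generating set $\{x_0,x_1\}$ induced by those vertices which can be expressed in the form $wv$, where $w$ is a positive word of length $\le k$ in the infinite generating set $\{x_0,x_1,x_2,\dots\}$ and $v$ is a positive word (of any length) in $\{x_0,\dots,x_l\}$. Then $\Gamma_k^l$ is not amenable.
   Context: Thompson's group $F$ is the group with presentation $\langle x_0,x_1,x_2,\dots \mid x_ix_j=x_jx_{i-1}\ \text{for all } i>j+1\rangle$; in particular $x_i=x_0^{i-1}x_1x_0^{-(i-1)}$ for $i\ge 1$, so $F$ is generated by $\{x_0,x_1\}$. A positive word is a (possibly empty) word in the indicated generators using no inverses. The (right) Cayley graph of $F$ has vertex set $F$, with $g,g'$ joined by an edge iff $g'=ga$ for some generator $a\in\{x_0,x_1\}$ (or vice versa). The subgraph induced by a set of vertices has those vertices and all edges between them. A graph $\Gamma$ of bounded degree is called amenable (in the Følner sense) if for every $\epsilon>0$ there is a finite nonempty set $A$ of vertices of $\Gamma$ with $\#\partial(A)/\#A<\epsilon$, where $\#\partial(A)$ is the number of edges of $\Gamma$ connecting a vertex in $A$ to a vertex of $\Gamma$ outside $A$. *)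

theory Defs
  imports "HOL-Algebra.Algebra" Complex_Main
begin

section \<open>Groups given by generators and relations\<close>

text \<open>The letter \<open>(a, True)\<close> stands for the generator \<open>a\<close> and \<open>(a, False)\<close> for its formal inverse.
  The generating set is the whole type \<open>'a\<close>; a relation \<open>u = v\<close> is the pair \<open>(u, v)\<close>.\<close>

type_synonym 'a gword = "('a \<times> bool) list"

inductive pres_eq :: "('a gword \<times> 'a gword) set \<Rightarrow> 'a gword \<Rightarrow> 'a gword \<Rightarrow> bool"
  for R :: "('a gword \<times> 'a gword) set" where
  refl: "pres_eq R u u"
| sym: "pres_eq R u v \<Longrightarrow> pres_eq R v u"
| trans: "pres_eq R u v \<Longrightarrow> pres_eq R v w \<Longrightarrow> pres_eq R u w"
| cancel: "pres_eq R (p @ [(a, b), (a, \<not> b)] @ q) (p @ q)"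
| rel: "(u, v) \<in> R \<Longrightarrow> pres_eq R (p @ u @ q) (p @ v @ q)"

definition word_class :: "('a gword \<times> 'a gword) set \<Rightarrow> 'a gword \<Rightarrow> 'a gword set" where
  "word_class R u = {v. pres_eq R u v}"

definition presented_group :: "('a gword \<times> 'a gword) set \<Rightarrow> 'a gword set monoid" where
  "presented_group R =
    \<lparr>carrier = range (word_class R),
     monoid.mult = (\<lambda>A B. \<Union>u\<in>A. \<Union>v\<in>B. word_class R (u @ v)),
     monoid.one = word_class R []\<rparr>"

definition presented_gen :: "('a gword \<times> 'a gword) set \<Rightarrow> 'a \<Rightarrow> 'a gword set" where
  "presented_gen R a = word_class R [(a, True)]"

lemma word_class_eq_iff: "word_class R u = word_class R v \<longleftrightarrow> pres_eq R u v"
proof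
  assume "word_class R u = word_class R v"
  then have "v \<in> word_class R u" by (simp add: word_class_def pres_eq.refl)
  then show "pres_eq R u v" by (simp add: word_class_def)
next
  assume *: "pres_eq R u v"
  show "word_class R u = word_class R v"
    unfolding word_class_def using pres_eq.trans[OF *] pres_eq.trans[OF pres_eq.sym[OF *]] by blast
qed

lemma pres_eq_context: "pres_eq R u v \<Longrightarrow> pres_eq R (p @ u @ q) (p @ v @ q)"
proof (induction rule: pres_eq.induct)
  case (cancel p' a b q')
  then show ?case using pres_eq.cancel[of R "p @ p'" a b "q' @ q"] by simp
next
  case (rel u v p' q')
  then show ?case using pres_eq.rel[of u v R "p @ p'" "q' @ q"] by simp
next
  case (trans u v w)
  then show ?case by (blast intro: pres_eq.trans)
qed (simp_all add: pres_eq.refl pres_eq.sym)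

lemma pres_eq_append:
  assumes "pres_eq R u u'" "pres_eq R v v'"
  shows "pres_eq R (u @ v) (u' @ v')"
  using pres_eq_context[OF assms(1), of "[]" v] pres_eq_context[OF assms(2), of u' "[]"]
  by (simp add: pres_eq.trans[of R "u @ v" "u' @ v" "u' @ v'"])

lemma presented_mult:
  "word_class R u \<otimes>\<^bsub>presented_group R\<^esub> word_class R v = word_class R (u @ v)"
proof -
  have "word_class R (a @ b) = word_class R (u @ v)"
    if "a \<in> word_class R u" "b \<in> word_class R v" for a b
  proof -
    have "pres_eq R u a" "pres_eq R v b" using that by (simp_all add: word_class_def)
    then have "pres_eq R (a @ b) (u @ v)" by (rule pres_eq.sym[OF pres_eq_append])
    then show ?thesis by (simp only: word_class_eq_iff)
  qed
  then have "(\<Union>a\<in>word_class R u. \<Union>b\<in>word_class R v. word_class R (a @ b)) =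
      (\<Union>a\<in>word_class R u. \<Union>b\<in>word_class R v. word_class R (u @ v))"
    by (simp cong: SUP_cong)
  moreover have "u \<in> word_class R u" "v \<in> word_class R v"
    by (auto simp: word_class_def pres_eq.refl)
  ultimately show ?thesis unfolding presented_group_def monoid.simps by blast
qed

lemma pres_eq_inverse: "pres_eq R (map (\<lambda>(a, b). (a, \<not> b)) (rev u) @ u) []"
proof (induction u)
  case Nil
  show ?case by (simp add: pres_eq.refl)
next
  case (Cons x u)
  obtain a b where x: "x = (a, b)" by (cases x)
  let ?v = "map (\<lambda>(a, b). (a, \<not> b)) (rev u)"
  show ?case
    using pres_eq.trans[OF pres_eq.cancel[of R ?v a "\<not> b" u] Cons.IH] by (simp add: x)
qed

lemma presented_group_is_group: "group (presented_group R)"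
proof (rule groupI)
  show "\<exists>y\<in>carrier (presented_group R). y \<otimes>\<^bsub>presented_group R\<^esub> x = \<one>\<^bsub>presented_group R\<^esub>"
    if x: "x \<in> carrier (presented_group R)" for x
  proof -
    obtain u where u: "x = word_class R u" using x by (auto simp: presented_group_def)
    let ?y = "word_class R (map (\<lambda>(a, b). (a, \<not> b)) (rev u))"
    have "?y \<otimes>\<^bsub>presented_group R\<^esub> x = \<one>\<^bsub>presented_group R\<^esub>"
      unfolding u presented_mult using pres_eq_inverse[of R u]
      by (simp add: word_class_eq_iff presented_group_def)
    then show ?thesis by (rule bexI) (simp add: presented_group_def)
  qed
next
  fix x y assume "x \<in> carrier (presented_group R)" "y \<in> carrier (presented_group R)"
  then obtain u v where "x = word_class R u" "y = word_class R v"
    by (auto simp: presented_group_def)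
  then show "x \<otimes>\<^bsub>presented_group R\<^esub> y \<in> carrier (presented_group R)"
    by (simp add: presented_mult) (simp add: presented_group_def)
next
  show "\<one>\<^bsub>presented_group R\<^esub> \<in> carrier (presented_group R)" by (simp add: presented_group_def)
next
  fix x y z
  assume "x \<in> carrier (presented_group R)" "y \<in> carrier (presented_group R)"
    "z \<in> carrier (presented_group R)"
  then obtain u v w where "x = word_class R u" "y = word_class R v" "z = word_class R w"
    by (auto simp: presented_group_def)
  then show "x \<otimes>\<^bsub>presented_group R\<^esub> y \<otimes>\<^bsub>presented_group R\<^esub> z =
      x \<otimes>\<^bsub>presented_group R\<^esub> (y \<otimes>\<^bsub>presented_group R\<^esub> z)"
    by (simp add: presented_mult)
next
  fix x assume "x \<in> carrier (presented_group R)"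
  then obtain u where u: "x = word_class R u" by (auto simp: presented_group_def)
  have "\<one>\<^bsub>presented_group R\<^esub> = word_class R []" by (simp add: presented_group_def)
  then show "\<one>\<^bsub>presented_group R\<^esub> \<otimes>\<^bsub>presented_group R\<^esub> x = x" by (simp add: u presented_mult)
qed

section \<open>Thompson's group F\<close>

definition thompson_relations :: "(nat gword \<times> nat gword) set" where
  "thompson_relations =
    {([(i, True), (j, True)], [(j, True), (i - 1, True)]) | i j. i > j + 1}"

definition thompson_F :: "nat gword set monoid" where
  "thompson_F = presented_group thompson_relations"

definition thompson_x :: "nat \<Rightarrow> nat gword set" where
  "thompson_x = presented_gen thompson_relations"

lemma thompson_F_group: "group thompson_F"
  by (simp add: thompson_F_def presented_group_is_group)

lemma thompson_x_closed: "thompson_x i \<in> carrier thompson_F"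
  by (simp add: thompson_x_def thompson_F_def presented_gen_def presented_group_def)

lemma thompson_x_relation:
  assumes "i > j + 1"
  shows "thompson_x i \<otimes>\<^bsub>thompson_F\<^esub> thompson_x j = thompson_x j \<otimes>\<^bsub>thompson_F\<^esub> thompson_x (i - 1)"
proof -
  have "([(i, True), (j, True)], [(j, True), (i - 1, True)]) \<in> thompson_relations"
    using assms by (auto simp: thompson_relations_def)
  from pres_eq.rel[OF this, of "[]" "[]"] show ?thesis
    by (simp add: thompson_x_def thompson_F_def presented_gen_def presented_mult word_class_eq_iff)
qed

text \<open>The element of F represented by the positive word \<open>x\<^bsub>i1\<^esub> \<cdots> x\<^bsub>in\<^esub>\<close>, given by its list of indices.\<close>

definition positive_element :: "nat list \<Rightarrow> nat gword set" where
  "positive_element w = foldr (monoid.mult thompson_F) (map thompson_x w) \<one>\<^bsub>thompson_F\<^esub>"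

section \<open>Graphs and amenability\<close>

text \<open>Undirected graphs; an edge is the set of its endpoints, so multiplicities are not recorded.
  In the Cayley graph of F none arise: the images of \<open>x\<^sub>0\<close> and \<open>x\<^sub>1\<close> in the abelianization are independent.\<close>

record 'v graph =
  verts :: "'v set"
  edges :: "'v set set"

definition induced_subgraph :: "'v graph \<Rightarrow> 'v set \<Rightarrow> 'v graph" where
  "induced_subgraph \<Gamma> S =
    \<lparr>verts = verts \<Gamma> \<inter> S, edges = {e \<in> edges \<Gamma>. e \<subseteq> S}\<rparr>"

definition edge_boundary :: "'v graph \<Rightarrow> 'v set \<Rightarrow> 'v set set" where
  "edge_boundary \<Gamma> A = {e \<in> edges \<Gamma>. \<exists>u\<in>A. \<exists>v\<in>verts \<Gamma> - A. e = {u, v}}"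

text \<open>Intended for graphs of bounded degree, where the boundary of a finite set is finite
  and \<open>card\<close> therefore counts it.\<close>

definition amenable :: "'v graph \<Rightarrow> bool" where
  "amenable \<Gamma> \<longleftrightarrow>
    (\<forall>\<epsilon>::real. \<epsilon> > 0 \<longrightarrow>
      (\<exists>A. A \<subseteq> verts \<Gamma> \<and> finite A \<and> A \<noteq> {} \<and>
        real (card (edge_boundary \<Gamma> A)) / real (card A) < \<epsilon>))"

definition cayley_graph :: "('g, 'm) monoid_scheme \<Rightarrow> 'g set \<Rightarrow> 'g graph" where
  "cayley_graph G S =
    \<lparr>verts = carrier G, edges = {{g, g \<otimes>\<^bsub>G\<^esub> a} | g a. g \<in> carrier G \<and> a \<in> S}\<rparr>"

lemma finite_edge_boundary_cayley:
  assumes "group G" "S \<subseteq> carrier G" "finite S" "finite A"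
  shows "finite (edge_boundary (induced_subgraph (cayley_graph G S) T) A)"
proof -
  interpret group G by fact
  let ?E = "(\<lambda>(g, a). {g, g \<otimes>\<^bsub>G\<^esub> a}) ` (A \<times> S) \<union> (\<lambda>(g, a). {g \<otimes>\<^bsub>G\<^esub> inv\<^bsub>G\<^esub> a, g}) ` (A \<times> S)"
  have "e \<in> ?E" if e: "e \<in> edge_boundary (induced_subgraph (cayley_graph G S) T) A" for e
  proof -
    obtain u v where u: "u \<in> A" "e = {u, v}" and "e \<in> edges (cayley_graph G S)"
      using e by (auto simp: edge_boundary_def induced_subgraph_def)
    then obtain g a where ga: "g \<in> carrier G" "a \<in> S" "e = {g, g \<otimes>\<^bsub>G\<^esub> a}"
      by (auto simp: cayley_graph_def)
    have ue: "u \<in> e" using u by simp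
    have g: "(g \<otimes>\<^bsub>G\<^esub> a) \<otimes>\<^bsub>G\<^esub> inv\<^bsub>G\<^esub> a = g"
      using ga assms(2) by (simp add: subset_iff m_assoc)
    show ?thesis
    proof (cases "u = g")
      case True
      then have "e = (\<lambda>(g, a). {g, g \<otimes>\<^bsub>G\<^esub> a}) (u, a)" "(u, a) \<in> A \<times> S" using ga u by auto
      then show ?thesis by blast
    next
      case False
      then have "u = g \<otimes>\<^bsub>G\<^esub> a" using ga ue by simp
      then have "e = (\<lambda>(g, a). {g \<otimes>\<^bsub>G\<^esub> inv\<^bsub>G\<^esub> a, g}) (u, a)" "(u, a) \<in> A \<times> S"
        using ga u g by simp_all
      then show ?thesis by blast
    qed
  qed
  then have "edge_boundary (induced_subgraph (cayley_graph G S) T) A \<subseteq> ?E" by blast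
  moreover have "finite ?E" using assms by simp
  ultimately show ?thesis by (rule finite_subset)
qed

section \<open>The subgraphs of the Cayley graph of F\<close>

definition Gamma_verts :: "nat \<Rightarrow> nat \<Rightarrow> nat gword set set" where
  "Gamma_verts k l =
    {positive_element w \<otimes>\<^bsub>thompson_F\<^esub> positive_element v | w v. length w \<le> k \<and> set v \<subseteq> {0..l}}"

definition Gamma_graph :: "nat \<Rightarrow> nat \<Rightarrow> nat gword set graph" where
  "Gamma_graph k l =
    induced_subgraph (cayley_graph thompson_F {thompson_x 0, thompson_x 1}) (Gamma_verts k l)"

end

(* Put V for the vertex set of the graph, which is closed under right multiplication by x_0 and x_1.
   The sets V x_0^l and V x_1^(k+1) are disjoint, so for a finite A in V the translates
   A x_0^l and A x_1^(k+1) cannot both overlap much with A; this gives #A <= (l + k + 1) #boundary(A).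

   In terms of forests (right multiplication by x_n joins the trees n and n+1), an element of V has at
   most k carets in each tree with index greater than l. Dividing an element of V x_1^(k+1) by x_0^l
   on the right moves its tree 1, which has more than k carets, to position l + 1.
   The carets of the trees are counted by the action of F on the real line in which x_n fixes
   (-oo, n], stretches [n, n+1] by the factor 2 and shifts [n+1, oo) by 1: the images of p and p+1
   differ by the number of leaves of tree p. *)

theory Submission imports Defs begin

section \<open>Disjoint translates and amenability\<close>

text \<open>Each further factor \<open>a\<close> adds at most one overhang: an element of
  \<open>A a^(n+1)\<close> outside \<open>A\<close> comes either from an element of
  \<open>A a^n\<close> already outside \<open>A\<close>, or from a point of \<open>A\<close> that
  leaves \<open>A\<close> under \<open>a\<close>.\<close>

lemma (in group) card_translate_diff_pow_le:
  assumes "finite A" "A \<subseteq> carrier G" "a \<in> carrier G"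
  shows "card ((\<lambda>g. g \<otimes> a [^] (n::nat)) ` A - A) \<le> n * card ((\<lambda>g. g \<otimes> a) ` A - A)"
proof (induction n)
  case 0
  have "(\<lambda>g. g \<otimes> a [^] (0::nat)) ` A = A" using assms(2) by (force simp: subset_iff)
  then show ?case by simp
next
  case (Suc n)
  let ?B = "(\<lambda>g. g \<otimes> a [^] n) ` A - A" and ?C = "(\<lambda>g. g \<otimes> a) ` A - A"
  have "g \<otimes> a [^] Suc n = (g \<otimes> a [^] n) \<otimes> a" if "g \<in> A" for g
    using that assms by (simp add: m_assoc subset_iff)
  then have "(\<lambda>g. g \<otimes> a [^] Suc n) ` A - A \<subseteq> (\<lambda>g. g \<otimes> a) ` ?B \<union> ?C" by auto
  then have "card ((\<lambda>g. g \<otimes> a [^] Suc n) ` A - A) \<le> card ((\<lambda>g. g \<otimes> a) ` ?B \<union> ?C)"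
    using assms(1) by (intro card_mono) auto
  also have "\<dots> \<le> card ((\<lambda>g. g \<otimes> a) ` ?B) + card ?C" by (rule card_Un_le)
  also have "card ((\<lambda>g. g \<otimes> a) ` ?B) \<le> card ?B" using assms(1) by (intro card_image_le) auto
  finally show ?case using Suc.IH by simp
qed

text \<open>Each point \<open>h\<close> of \<open>A a\<close> outside \<open>A\<close> is charged to
  the edge from \<open>h a^(-1)\<close>, which lies in \<open>A\<close>, to \<open>h\<close>;
  closure of \<open>T\<close> under \<open>a\<close> keeps this edge in the induced
  subgraph.\<close>

lemma (in group) card_translate_diff_le_edge_boundary:
  assumes "S \<subseteq> carrier G" "finite S" "T \<subseteq> carrier G" "a \<in> S"
    and closed: "\<And>g. g \<in> T \<Longrightarrow> g \<otimes> a \<in> T"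
    and A: "finite A" "A \<subseteq> T"
  shows "card ((\<lambda>g. g \<otimes> a) ` A - A)
    \<le> card (edge_boundary (induced_subgraph (cayley_graph G S) T) A)"
proof -
  let ?e = "\<lambda>h. {h \<otimes> inv a, h}"
  let ?B = "(\<lambda>g. g \<otimes> a) ` A - A"
  have a: "a \<in> carrier G" using assms by blast
  have pre: "h \<otimes> inv a \<in> A" if "h \<in> ?B" for h
    using that a A assms(3) by (auto simp: m_assoc subset_iff)
  have "inj_on ?e ?B"
  proof (rule inj_onI)
    fix h h' assume *: "h \<in> ?B" "h' \<in> ?B" "?e h = ?e h'"
    have "h \<otimes> inv a \<in> A" "h' \<otimes> inv a \<in> A" "h \<notin> A" "h' \<notin> A"
      using pre[OF *(1)] pre[OF *(2)] *(1,2) by simp_all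
    \<comment> \<open>The edge determines \<open>h\<close> as its only endpoint outside
      \<open>A\<close>.\<close>
    then have "?e h - A = {h}" "?e h' - A = {h'}" by (simp_all add: insert_Diff_if)
    then have "{h} = {h'}" using *(3) by (simp only:)
    then show "h = h'" by (rule singleton_inject)
  qed
  moreover have "?e ` ?B \<subseteq> edge_boundary (induced_subgraph (cayley_graph G S) T) A"
  proof
    fix e assume "e \<in> ?e ` ?B"
    then obtain h where h: "h \<in> ?B" and e: "e = ?e h" by blast
    then obtain g where g: "g \<in> A" "h = g \<otimes> a" by blast
    then have gc: "g \<in> carrier G" "g \<in> T" using A assms(3) by auto
    have "e = {g, g \<otimes> a}" using e g gc a by (simp add: m_assoc)
    moreover have "g \<otimes> a \<in> T" using closed gc by blast
    moreover have "g \<otimes> a \<in> carrier G" "g \<otimes> a \<notin> A" using gc a h g by auto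
    ultimately show "e \<in> edge_boundary (induced_subgraph (cayley_graph G S) T) A"
      using gc g assms(4) by (auto simp: edge_boundary_def induced_subgraph_def cayley_graph_def)
  qed
  ultimately show ?thesis
    using finite_edge_boundary_cayley[OF is_group assms(1,2) A(1)] by (meson card_inj_on_le)
qed

text \<open>The two disjoint translates have \<open>2 * card A\<close> elements together, but they
  lie in \<open>A\<close> and two overhangs bounded by \<open>m\<close> and \<open>n\<close> times
  the boundary.\<close>

lemma (in group) not_amenable_if_disjoint_translates:
  fixes m n :: nat
  assumes "S \<subseteq> carrier G" "finite S" "T \<subseteq> carrier G" "a \<in> S" "b \<in> S"
    and "\<And>g. g \<in> T \<Longrightarrow> g \<otimes> a \<in> T" "\<And>g. g \<in> T \<Longrightarrow> g \<otimes> b \<in> T"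
    and disj: "\<And>g h. g \<in> T \<Longrightarrow> h \<in> T \<Longrightarrow> g \<otimes> a [^] m \<noteq> h \<otimes> b [^] n"
  shows "\<not> amenable (induced_subgraph (cayley_graph G S) T)"
proof
  let ?\<Gamma> = "induced_subgraph (cayley_graph G S) T"
  assume "amenable ?\<Gamma>"
  \<comment> \<open>The summand 1 keeps the threshold positive even for
    \<open>m = n = 0\<close>.\<close>
  then obtain A where AV: "A \<subseteq> verts ?\<Gamma>" and fin: "finite A" and ne: "A \<noteq> {}"
    and small: "real (card (edge_boundary ?\<Gamma> A)) / real (card A) < 1 / real (m + n + 1)"
    unfolding amenable_def by (metis of_nat_0_less_iff zero_less_divide_1_iff add_gr_0 zero_less_one)
  have AT: "A \<subseteq> T" using AV by (auto simp: induced_subgraph_def)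
  then have AG: "A \<subseteq> carrier G" using assms(3) by blast
  have ab: "a \<in> carrier G" "b \<in> carrier G" using assms by auto
  let ?P = "(\<lambda>g. g \<otimes> a [^] m) ` A" and ?Q = "(\<lambda>g. g \<otimes> b [^] n) ` A"
  let ?d = "card (edge_boundary ?\<Gamma> A)"
  have card_translate: "card ((\<lambda>g. g \<otimes> c) ` A) = card A" if "c \<in> carrier G" for c
    using that AG by (intro card_image inj_onI) (auto simp: subset_iff)
  have "?P \<inter> ?Q = {}" using disj AT by blast
  then have "2 * card A = card (?P \<union> ?Q)"
    using card_translate[of "a [^] m"] card_translate[of "b [^] n"] ab fin
    by (subst card_Un_disjoint) auto
  also have "\<dots> \<le> card (A \<union> ((?P - A) \<union> (?Q - A)))"
    using fin by (intro card_mono) auto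
  also have "\<dots> \<le> card A + (card (?P - A) + card (?Q - A))"
    by (meson card_Un_le add_left_mono order_trans)
  also have "card (?P - A) \<le> m * ?d"
    using card_translate_diff_pow_le[OF fin AG ab(1), of m]
      card_translate_diff_le_edge_boundary[OF assms(1-4) assms(6) fin AT]
    by (meson mult_le_mono2 order_trans)
  also have "card (?Q - A) \<le> n * ?d"
    using card_translate_diff_pow_le[OF fin AG ab(2), of n]
      card_translate_diff_le_edge_boundary[OF assms(1-3) assms(5) assms(7) fin AT]
    by (meson mult_le_mono2 order_trans)
  finally have "card A \<le> (m + n) * ?d" by (simp add: algebra_simps)
  also have "\<dots> \<le> (m + n + 1) * ?d" by simp
  finally have "real (card A) \<le> real (m + n + 1) * real ?d"
    by (simp only: of_nat_mult[symmetric] of_nat_le_iff)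
  moreover have "real (card A) > 0" using fin ne by (simp add: card_gt_0_iff)
  ultimately show False using small by (simp add: field_simps)
qed

section \<open>The action of F on the real line\<close>

definition stretch :: "nat \<Rightarrow> real \<Rightarrow> real" where
  "stretch n t = t + max 0 (min 1 (t - real n))"

text \<open>The inverse of \<open>stretch n\<close>: slope 1/2 on the interval from \<open>n\<close>
  to \<open>n + 2\<close>, a shift by -1 beyond it.\<close>

definition shrink :: "nat \<Rightarrow> real \<Rightarrow> real" where
  "shrink n t = t - max 0 (min 1 ((t - real n) / 2))"

text \<open>The last letter acts first, so multiplying on the right changes the point at which the
  left factor is evaluated.\<close>

fun word_action :: "nat gword \<Rightarrow> real \<Rightarrow> real" where
  "word_action [] = id"
| "word_action ((n, s) # u) = (if s then stretch n else shrink n) \<circ> word_action u"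

lemma shrink_stretch [simp]: "shrink n (stretch n t) = t"
  by (auto simp: stretch_def shrink_def max_def min_def field_simps)

lemma stretch_shrink [simp]: "stretch n (shrink n t) = t"
  by (auto simp: stretch_def shrink_def max_def min_def field_simps)

text \<open>Since \<open>i - 1 \<ge> j + 1\<close>, the map \<open>stretch j\<close> shifts the
  interval from \<open>i - 1\<close> to \<open>i\<close> rigidly onto the one from \<open>i\<close>
  to \<open>i + 1\<close>, so it carries the stretching by \<open>x_(i-1)\<close> to that by
  \<open>x_i\<close>.\<close>

lemma stretch_relation:
  assumes "j + 1 < i"
  shows "stretch i (stretch j t) = stretch j (stretch (i - 1) t)"
proof -
  have "real (i - 1) = real i - 1" "real i \<ge> real j + 2" using assms by auto
  then show ?thesis by (auto simp: stretch_def max_def min_def)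
qed

lemma word_action_append: "word_action (u @ v) = word_action u \<circ> word_action v"
  by (induction u rule: word_action.induct) (auto simp: comp_assoc)

text \<open>This makes the action well defined on F: an equation in F can be tested at points of the
  line.\<close>

lemma word_action_cong: "pres_eq thompson_relations u v \<Longrightarrow> word_action u = word_action v"
proof (induction rule: pres_eq.induct)
  case (cancel p a b q)
  then show ?case by (auto simp: word_action_append fun_eq_iff)
next
  case (rel u v p q)
  then show ?case
    by (auto simp: word_action_append fun_eq_iff thompson_relations_def stretch_relation)
qed auto

definition positive_word :: "nat list \<Rightarrow> nat gword" where
  "positive_word w = map (\<lambda>i. (i, True)) w"

lemma positive_word_append: "positive_word (u @ v) = positive_word u @ positive_word v"
  by (simp add: positive_word_def)

lemma positive_element_eq: "positive_element w = word_class thompson_relations (positive_word w)"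
proof (induction w)
  case Nil
  show ?case
    by (simp add: positive_element_def positive_word_def thompson_F_def presented_group_def)
next
  case (Cons i w)
  have "positive_element (i # w) = thompson_x i \<otimes>\<^bsub>thompson_F\<^esub> positive_element w"
    by (simp add: positive_element_def)
  also have "\<dots> = word_class thompson_relations ([(i, True)] @ positive_word w)"
    unfolding Cons.IH thompson_x_def presented_gen_def thompson_F_def by (rule presented_mult)
  finally show ?case by (simp add: positive_word_def)
qed

lemma positive_element_append:
  "positive_element (u @ v) = positive_element u \<otimes>\<^bsub>thompson_F\<^esub> positive_element v"
  by (simp add: positive_element_eq positive_word_append thompson_F_def presented_mult)

lemma positive_element_closed: "positive_element w \<in> carrier thompson_F"
  by (simp add: positive_element_eq thompson_F_def presented_group_def)

lemma thompson_x_pow: "thompson_x i [^]\<^bsub>thompson_F\<^esub> n = positive_element (replicate n i)"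
proof (induction n)
  case 0
  show ?case by (simp add: positive_element_def)
next
  case (Suc n)
  interpret group thompson_F by (rule thompson_F_group)
  have "positive_element [i] = thompson_x i"
    using thompson_x_closed[of i] by (simp add: positive_element_def)
  then have "positive_element (replicate n i @ [i]) = thompson_x i [^]\<^bsub>thompson_F\<^esub> Suc n"
    by (simp add: positive_element_append Suc.IH)
  then show ?case by (simp add: replicate_append_same)
qed

abbreviation positive_action :: "nat list \<Rightarrow> real \<Rightarrow> real" where
  "positive_action w \<equiv> word_action (positive_word w)"

lemma positive_action_append: "positive_action (u @ v) = positive_action u \<circ> positive_action v"
  by (simp add: positive_word_append word_action_append)

lemma positive_action_Cons [simp]: "positive_action (i # w) t = stretch i (positive_action w t)"
  by (simp add: positive_word_def)

lemma positive_action_Nil [simp]: "positive_action [] t = t"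
  by (simp add: positive_word_def)

text \<open>Each letter moves a point to the right by at most 1.\<close>

lemma positive_action_bounds: "t \<le> positive_action w t \<and> positive_action w t \<le> t + length w"
  by (induction w) (auto simp: stretch_def max_def min_def)

text \<open>Every \<open>stretch\<close> has slopes 1 and 2 only, so it shortens no
  distance.\<close>

lemma positive_action_expansive:
  "s \<le> t \<Longrightarrow> t - s \<le> positive_action w t - positive_action w s"
  by (induction w) (auto simp: stretch_def max_def min_def)

text \<open>The point only moves right, so it stays in the region where every letter adds a full
  1.\<close>

lemma positive_action_shift:
  assumes "\<forall>i\<in>set w. real i + 1 \<le> t"
  shows "positive_action w t = t + length w"
  using assms by (induction w) (auto simp: stretch_def)

lemma positive_action_fixed:
  assumes "\<forall>i\<in>set w. t \<le> real i"
  shows "positive_action w t = t"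
  using assms by (induction w) (auto simp: stretch_def)

text \<open>The letters of \<open>v\<close> shift both points equally and preserve their distance 1;
  then each of the at most \<open>k\<close> letters of \<open>w\<close> adds at most 1. In forest
  terms, tree \<open>l + 1\<close> has at most \<open>k\<close> carets.\<close>

lemma positive_action_gap_le:
  assumes "set v \<subseteq> {0..l}" "length w \<le> k"
  shows "positive_action (w @ v) (real l + 2) - positive_action (w @ v) (real l + 1) \<le> real k + 1"
proof -
  have "positive_action v t = t + length v" if "t \<ge> real l + 1" for t
    using that assms(1) by (intro positive_action_shift) force
  then show ?thesis
    using positive_action_bounds[of "real l + 2 + length v" w]
      positive_action_bounds[of "real l + 1 + length v" w] assms(2)
    by (simp add: positive_action_append)
qed

section \<open>Nonamenability\<close>

lemma Gamma_verts_eq: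
  "Gamma_verts k l = {positive_element (w @ v) | w v. length w \<le> k \<and> set v \<subseteq> {0..l}}"
  by (simp add: Gamma_verts_def positive_element_append)

lemma Gamma_verts_closed:
  assumes "g \<in> Gamma_verts k l" "i \<le> l"
  shows "g \<otimes>\<^bsub>thompson_F\<^esub> thompson_x i \<in> Gamma_verts k l"
proof -
  interpret group thompson_F by (rule thompson_F_group)
  obtain w v where wv: "g = positive_element (w @ v)" "length w \<le> k" "set v \<subseteq> {0..l}"
    using assms(1) by (auto simp: Gamma_verts_eq)
  have "thompson_x i = positive_element [i]"
    using thompson_x_closed[of i] by (simp add: positive_element_def)
  then have "g \<otimes>\<^bsub>thompson_F\<^esub> thompson_x i = positive_element (w @ (v @ [i]))"
    using wv by (simp flip: positive_element_append)
  moreover have "set (v @ [i]) \<subseteq> {0..l}" using wv assms(2) by simp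
  ultimately show ?thesis using wv(2) unfolding Gamma_verts_eq by blast
qed

text \<open>Both sides are evaluated at 1 and 2. On the left, \<open>x_0^l\<close> moves these
  points to \<open>l + 1\<close> and \<open>l + 2\<close>, whose images under \<open>g\<close> are
  at most \<open>k + 1\<close> apart. On the right, \<open>x_1^(k+1)\<close> moves them to distance
  \<open>k + 2\<close>, which the positive element \<open>h\<close> cannot shorten.\<close>

lemma Gamma_verts_translates_disjoint:
  assumes "g \<in> Gamma_verts k l" "h \<in> Gamma_verts k l"
  shows "g \<otimes>\<^bsub>thompson_F\<^esub> thompson_x 0 [^]\<^bsub>thompson_F\<^esub> l
    \<noteq> h \<otimes>\<^bsub>thompson_F\<^esub> thompson_x 1 [^]\<^bsub>thompson_F\<^esub> (k + 1)"
proof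
  assume eq: "g \<otimes>\<^bsub>thompson_F\<^esub> thompson_x 0 [^]\<^bsub>thompson_F\<^esub> l
    = h \<otimes>\<^bsub>thompson_F\<^esub> thompson_x 1 [^]\<^bsub>thompson_F\<^esub> (k + 1)"
  obtain w v where wv: "g = positive_element (w @ v)" "length w \<le> k" "set v \<subseteq> {0..l}"
    using assms(1) by (auto simp: Gamma_verts_eq)
  obtain u where u: "h = positive_element u" using assms(2) by (auto simp: Gamma_verts_eq)
  have "positive_element ((w @ v) @ replicate l 0) = positive_element (u @ replicate (k + 1) 1)"
    using eq unfolding wv u thompson_x_pow positive_element_append .
  then have "positive_action ((w @ v) @ replicate l 0) = positive_action (u @ replicate (k + 1) 1)"
    unfolding positive_element_eq word_class_eq_iff by (rule word_action_cong)
  then have action: "positive_action (w @ v) (positive_action (replicate l 0) t)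
      = positive_action u (positive_action (replicate (k + 1) 1) t)" for t
    unfolding positive_action_append by (metis comp_apply)
  have x0: "positive_action (replicate l 0) t = t + real l" if "t \<ge> 1" for t
    using positive_action_shift[of "replicate l 0" t] that by simp
  \<comment> \<open>The point 1 is the left end of the interval stretched by \<open>x_1\<close>,
    hence fixed; 2 is its right end, so each of the \<open>k + 1\<close> letters adds 1.\<close>
  have x1: "positive_action (replicate (k + 1) 1) 1 = 1"
    "positive_action (replicate (k + 1) 1) 2 = real k + 3"
    using positive_action_fixed[of "replicate (k + 1) 1" 1]
      positive_action_shift[of "replicate (k + 1) 1" 2] by (simp_all del: replicate.simps)
  have "positive_action (w @ v) (real l + 1) = positive_action u 1"
    using action[of 1] x0[of 1] x1 by (simp add: add.commute)
  moreover have "positive_action (w @ v) (real l + 2) = positive_action u (real k + 3)"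
    using action[of 2] x0[of 2] x1 by (simp add: add.commute)
  ultimately have "positive_action u (real k + 3) - positive_action u 1 \<le> real k + 1"
    using positive_action_gap_le[OF wv(3,2)] by simp
  then show False using positive_action_expansive[of 1 "real k + 3" u] by simp
qed

theorem theorem1p1:
  fixes k l :: nat
  assumes "l > 0"
  shows "\<not> amenable (Gamma_graph k l)"
  unfolding Gamma_graph_def
proof (rule group.not_amenable_if_disjoint_translates[OF thompson_F_group,
      where m = l and n = "k + 1"])
  show "Gamma_verts k l \<subseteq> carrier thompson_F"
    by (auto simp: Gamma_verts_eq positive_element_closed)
  show "thompson_x 0 \<in> {thompson_x 0, thompson_x 1}" "thompson_x 1 \<in> {thompson_x 0, thompson_x 1}"
    by simp_all
  \<comment> \<open>Closure under \<open>x_1\<close> uses \<open>l > 0\<close>: it makes 1 an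
    admissible index for the second factor \<open>v\<close>.\<close>
  show "g \<otimes>\<^bsub>thompson_F\<^esub> thompson_x 0 \<in> Gamma_verts k l"
    "g \<otimes>\<^bsub>thompson_F\<^esub> thompson_x 1 \<in> Gamma_verts k l" if "g \<in> Gamma_verts k l" for g
    using that assms by (simp_all add: Gamma_verts_closed)
  show "g \<otimes>\<^bsub>thompson_F\<^esub> thompson_x 0 [^]\<^bsub>thompson_F\<^esub> l
      \<noteq> h \<otimes>\<^bsub>thompson_F\<^esub> thompson_x 1 [^]\<^bsub>thompson_F\<^esub> (k + 1)"
    if "g \<in> Gamma_verts k l" "h \<in> Gamma_verts k l" for g h
    using that by (rule Gamma_verts_translates_disjoint)
qed (simp_all add: thompson_x_closed)

end
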